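(* For all real numbers $r,s,t$ there exist $a,b,c,d,e,f\in[0,1]$ such that \[\frac{2r+as+4bt}{2+a+4b}=\frac{4cr+2s+dt}{4c+2+d}=\frac{er+4fs+2t}{e+4f+2}=\tau(r,s,t).\]
   Context: For $x,y,z\in\mathbb{R}$, the independence target value $\tau(x,y,z)$ is defined as the median of the three numbers $\frac{2x+y}{3}$, $\frac{x+2z}{3}$, and $\frac{2y+z}{3}$. *)

theory Defs
  imports Complex_Main
begin

definition median3 :: "real \<Rightarrow> real \<Rightarrow> real \<Rightarrow> real" where
  "median3 u v w = sort [u, v, w] ! 1"

definition \<tau> :: "real \<Rightarrow> real \<Rightarrow> real \<Rightarrow> real" where
  "\<tau> x y z = median3 ((2 * x + y) / 3) ((x + 2 * z) / 3) ((2 * y + z) / 3)"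

end

(* Each of the three quotients, as its two free weights run over [0,1], takes every value between
   two of the three candidates for tau: the extreme choices (1,0) and (0,1) of the weights give
   these two candidates. The median of three numbers lies between any two of them. *)
theory Submission
  imports Defs
begin

lemma median3_between:
  "min u v \<le> median3 u v w" "median3 u v w \<le> max u v"
  "min u w \<le> median3 u v w" "median3 u v w \<le> max u w"
  "min v w \<le> median3 u v w" "median3 u v w \<le> max v w"
  by (auto simp: median3_def min_def max_def)

text \<open>The segment b = 1 - a already joins the two extreme choices of weights, so the
  intermediate value theorem in the single variable a suffices. The variables are generic because
  the three quotients arise from one another by cyclic shifts of (r, s, t).\<close>

lemma weighted_mean_between:
  fixes x y z m :: real
  assumes "min ((2 * x + y) / 3) ((x + 2 * z) / 3) \<le> m"
    and "m \<le> max ((2 * x + y) / 3) ((x + 2 * z) / 3)"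
  obtains a b where "a \<in> {0..1}" "b \<in> {0..1}" "(2 * x + a * y + 4 * b * z) / (2 + a + 4 * b) = m"
proof -
  define p q where "p = (2 * x + y) / 3" and "q = (x + 2 * z) / 3"
  \<comment> \<open>Eliminating y and z lets the later identity be checked by plain algebra in x, p,
    q, m and a.\<close>
  have y: "y = 3 * p - 2 * x" and z: "z = (3 * q - x) / 2"
    by (simp_all add: p_def q_def add_divide_distrib)
  (* With b = 1 - a the mean is that of p and q with weights 3 a and 6 b. *)
  have *: "\<exists>a\<in>{0..1}. a * (p - m) + 2 * (1 - a) * (q - m) = 0"
  proof (cases "p \<le> q")
    case True
    then have "p \<le> m" "m \<le> q"
      using assms by (auto simp: p_def q_def)
    \<comment> \<open>The function is 2 * (q - m) \<ge> 0 at a = 0 and p - m \<le> 0 at a = 1. In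
      the other case both signs are reversed.\<close>
    then show ?thesis
      using IVT2'[of "\<lambda>a. a * (p - m) + 2 * (1 - a) * (q - m)" 1 0 0]
      by (force intro!: continuous_intros)
  next
    case False
    then have "q \<le> m" "m \<le> p"
      using assms by (auto simp: p_def q_def)
    then show ?thesis
      using IVT'[of "\<lambda>a. a * (p - m) + 2 * (1 - a) * (q - m)" 0 0 1]
      by (force intro!: continuous_intros)
  qed
  then obtain a where a: "a \<in> {0..1}" "a * (p - m) + 2 * (1 - a) * (q - m) = 0"
    by blast
  have "2 * x + a * y + 4 * (1 - a) * z - m * (2 + a + 4 * (1 - a))
      = 3 * (a * (p - m) + 2 * (1 - a) * (q - m))"
    by (simp add: y z field_simps)
  then have "2 * x + a * y + 4 * (1 - a) * z = m * (2 + a + 4 * (1 - a))"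
    using a(2) by simp
  \<comment> \<open>The denominator is 6 - 3 * a, hence at least 3.\<close>
  moreover have "2 + a + 4 * (1 - a) \<noteq> 0"
    using a(1) by auto
  ultimately have "(2 * x + a * y + 4 * (1 - a) * z) / (2 + a + 4 * (1 - a)) = m"
    by (metis nonzero_mult_div_cancel_right)
  with a(1) show ?thesis
    by (intro that[of a "1 - a"]) auto
qed

theorem mainTheorem4:
  fixes r s t :: real
  shows "\<exists>a\<in>{0..1}. \<exists>b\<in>{0..1}. \<exists>c\<in>{0..1}. \<exists>d\<in>{0..1}. \<exists>e\<in>{0..1}. \<exists>f\<in>{0..1}.
    (2 * r + a * s + 4 * b * t) / (2 + a + 4 * b) = (4 * c * r + 2 * s + d * t) / (4 * c + 2 + d) \<and>
    (4 * c * r + 2 * s + d * t) / (4 * c + 2 + d) = (e * r + 4 * f * s + 2 * t) / (e + 4 * f + 2) \<and>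
    (e * r + 4 * f * s + 2 * t) / (e + 4 * f + 2) = \<tau> r s t"
proof -
  note between = median3_between[where u = "(2 * r + s) / 3" and v = "(r + 2 * t) / 3"
      and w = "(2 * s + t) / 3", folded \<tau>_def]
  obtain a b where "a \<in> {0..1}" "b \<in> {0..1}"
    "(2 * r + a * s + 4 * b * t) / (2 + a + 4 * b) = \<tau> r s t"
    using weighted_mean_between[OF between(1,2)] by metis
  \<comment> \<open>Shifting to (s, t, r) gives the candidates (2 * s + t) / 3 and (s + 2 * r) / 3,
    which are the third and the first; d and c take the places of a and b.\<close>
  moreover obtain d c where "d \<in> {0..1}" "c \<in> {0..1}"
    "(2 * s + d * t + 4 * c * r) / (2 + d + 4 * c) = \<tau> r s t"
    using weighted_mean_between[of s t r "\<tau> r s t"] between(3,4)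
    by (metis add.commute max.commute min.commute)
  \<comment> \<open>Shifting to (t, r, s) leaves the second and third candidates.\<close>
  moreover obtain e f where "e \<in> {0..1}" "f \<in> {0..1}"
    "(2 * t + e * r + 4 * f * s) / (2 + e + 4 * f) = \<tau> r s t"
    using weighted_mean_between[of t r s "\<tau> r s t"] between(5,6)
    by (metis add.commute max.commute min.commute)
  moreover have "4 * c * r + 2 * s + d * t = 2 * s + d * t + 4 * c * r"
    "4 * c + 2 + d = 2 + d + 4 * c"
    "e * r + 4 * f * s + 2 * t = 2 * t + e * r + 4 * f * s"
    "e + 4 * f + 2 = 2 + e + 4 * f"
    by simp_all
  ultimately show ?thesis
    by metis
qed

end
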